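(* Let $(X,d)$ be a metric space preordered by $\preccurlyeq$, such that for every $\preccurlyeq$-decreasing sequence $(x_n)_{n\ge1}\subset X$, $(x_n)_{n\ge1}$ is Cauchy and there exists $x\in X$ with $x\preccurlyeq x_n$ for all $n\ge1$. Then for every $x\in X$ there exists $\overline{x}\in X$ such that $\overline{x}\preccurlyeq x$ and, for every $x'\in X$, $x'\preccurlyeq\overline{x}$ implies $x'=\overline{x}$.
   Context: A preorder is a reflexive and transitive relation. A sequence $(x_n)_{n\ge1}$ is $\preccurlyeq$-decreasing if $x_{n+1}\preccurlyeq x_n$ for all $n\ge1$. *)

theory Defs
  imports "HOL-Analysis.Abstract_Metric_Spaces"
begin

end

theory Submission
  imports Defs
begin

text \<open>
  Call \<open>z\<close> \<open>e\<close>-terminal if everything below \<open>z\<close> lies within distance \<open>e\<close> of \<open>z\<close>. Below every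
  point there is an \<open>e\<close>-terminal one, since otherwise one could keep descending by jumps longer
  than \<open>e\<close>, producing a decreasing sequence that is not Cauchy. Descend through \<open>1/n\<close>-terminal
  points and take a lower bound \<open>y\<close> of the resulting sequence: anything below \<open>y\<close> is within \<open>1/n\<close>
  of the same point as \<open>y\<close>, for every \<open>n\<close>, hence equal to \<open>y\<close>.
\<close>

lemma (in Metric_space) ex_terminal_below:
  fixes le :: "'a \<Rightarrow> 'a \<Rightarrow> bool" (infix "\<preceq>" 50)
  assumes refl: "reflp_on M (\<preceq>)"
    and trans: "transp_on M (\<preceq>)"
    and Cauchy: "\<And>u. \<lbrakk>range u \<subseteq> M; \<forall>n. u (Suc n) \<preceq> u n\<rbrakk> \<Longrightarrow> MCauchy u"
    and y: "y \<in> M" and e: "e > 0"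
  shows "\<exists>z\<in>M. z \<preceq> y \<and> (\<forall>w\<in>M. w \<preceq> z \<longrightarrow> d z w < e)"
proof (rule ccontr)
  assume "\<not> ?thesis"
  then have jump: "\<exists>w\<in>M. w \<preceq> z \<and> e \<le> d z w" if "z \<in> M" "z \<preceq> y" for z
    using that by (meson not_less)
  \<comment> \<open>The invariant \<open>u n \<preceq> y\<close> is carried along because
    \<open>jump\<close> applies only to points below \<open>y\<close>; transitivity restores it
    after each jump.\<close>
  have "\<exists>u. \<forall>n. (u n \<in> M \<and> u n \<preceq> y) \<and> (u (Suc n) \<preceq> u n \<and> e \<le> d (u n) (u (Suc n)))"
  proof (rule dependent_nat_choice)
    show "\<exists>z. z \<in> M \<and> z \<preceq> y"
      using y refl by (meson reflp_onD)
    show "\<exists>w. (w \<in> M \<and> w \<preceq> y) \<and> (w \<preceq> z \<and> e \<le> d z w)" if "z \<in> M \<and> z \<preceq> y" for z n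
      using that jump[of z] y transp_onD[OF trans] by blast
  qed
  then obtain u where u: "\<And>n. u n \<in> M" "\<And>n. u (Suc n) \<preceq> u n"
    "\<And>n. e \<le> d (u n) (u (Suc n))"
    by blast
  have "MCauchy u"
    using u by (intro Cauchy) auto
  then obtain N where "\<forall>m n. N \<le> m \<longrightarrow> N \<le> n \<longrightarrow> d (u m) (u n) < e"
    unfolding MCauchy_def using e by blast
  then have "d (u N) (u (Suc N)) < e"
    by simp
  with u(3)[of N] show False
    by simp
qed

theorem corollary3p10:
  fixes X :: "'a set"
    and d :: "'a \<Rightarrow> 'a \<Rightarrow> real"
    and le :: "'a \<Rightarrow> 'a \<Rightarrow> bool" (infix "\<preceq>" 50)
  assumes "Metric_space X d"
    and "reflp_on X (\<preceq>)"
    and "transp_on X (\<preceq>)"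
    and "\<And>u :: nat \<Rightarrow> 'a.
           \<lbrakk>range u \<subseteq> X; \<forall>n. u (Suc n) \<preceq> u n\<rbrakk> \<Longrightarrow>
           Metric_space.MCauchy X d u \<and> (\<exists>x\<in>X. \<forall>n. x \<preceq> u n)"
  shows "\<forall>x\<in>X. \<exists>y\<in>X. y \<preceq> x \<and> (\<forall>z\<in>X. z \<preceq> y \<longrightarrow> z = y)"
proof
  fix x assume x: "x \<in> X"
  interpret Metric_space X d by fact
  \<comment> \<open>The clause for \<open>n = 0\<close> pins the start at \<open>x\<close> and is
    vacuous later. Terminality sits in the step relation, so it concerns only
    \<open>u (Suc n)\<close>; \<open>x\<close> itself may fail to be terminal.\<close>
  have "\<exists>u. \<forall>n. (u n \<in> X \<and> (n = 0 \<longrightarrow> u n = x)) \<and>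
      (u (Suc n) \<preceq> u n \<and> (\<forall>w\<in>X. w \<preceq> u (Suc n) \<longrightarrow> d (u (Suc n)) w < inverse (real (Suc n))))"
  proof (rule dependent_nat_choice)
    show "\<exists>z. z \<in> X \<and> (0 = (0::nat) \<longrightarrow> z = x)"
      using x by simp
    show "\<exists>z. (z \<in> X \<and> (Suc n = 0 \<longrightarrow> z = x)) \<and>
        (z \<preceq> v \<and> (\<forall>w\<in>X. w \<preceq> z \<longrightarrow> d z w < inverse (real (Suc n))))"
      if "v \<in> X \<and> (n = 0 \<longrightarrow> v = x)" for v n
    proof -
      have "\<exists>z\<in>X. z \<preceq> v \<and> (\<forall>w\<in>X. w \<preceq> z \<longrightarrow> d z w < inverse (real (Suc n)))"
        using that by (intro ex_terminal_below assms(2,3) conjunct1[OF assms(4)]) auto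
      then show ?thesis
        by blast
    qed
  qed
  then obtain u where u: "\<And>n. u n \<in> X" "u 0 = x" "\<And>n. u (Suc n) \<preceq> u n"
    and terminal: "\<And>n w. \<lbrakk>w \<in> X; w \<preceq> u (Suc n)\<rbrakk> \<Longrightarrow> d (u (Suc n)) w < inverse (real (Suc n))"
    by blast
  obtain y where y: "y \<in> X" "\<And>n. y \<preceq> u n"
    using assms(4)[of u] u by blast
  have "z = y" if z: "z \<in> X" "z \<preceq> y" for z
  proof (rule ccontr)
    assume "z \<noteq> y"
    then have "d z y / 2 > 0"
      using z y by simp
    \<comment> \<open>Half the distance, since \<open>z\<close> and \<open>y\<close> will both lie
      this close to \<open>u (Suc n)\<close> and the triangle inequality adds the two
      bounds.\<close>
    then obtain n where n: "inverse (real (Suc n)) < d z y / 2"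
      using reals_Archimedean by blast
    have "z \<preceq> u (Suc n)"
      using transp_onD[OF assms(3) z(1) y(1) u(1) z(2) y(2)] .
    then have "d (u (Suc n)) z < d z y / 2" "d (u (Suc n)) y < d z y / 2"
      using terminal[of z n] terminal[of y n] z y n by auto
    moreover have "d z y \<le> d (u (Suc n)) z + d (u (Suc n)) y"
      using triangle[OF z(1) u(1) y(1)] by (simp add: commute)
    ultimately show False
      by simp
  qed
  then show "\<exists>y\<in>X. y \<preceq> x \<and> (\<forall>z\<in>X. z \<preceq> y \<longrightarrow> z = y)"
    \<comment> \<open>\<open>y \<preceq> x\<close> is the lower bound property at index 0, as
      \<open>u 0 = x\<close>.\<close>
    using y u(2) by metis
qed

end
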